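(* Let $(a_n)_{n\ge0}$ be an increasing sequence in $[0,1)$ such that $a_0=0$ and $\lim_{n\to\infty}a_n=1$. (i) Let $(\lambda_n)_{n\ge 0}$ be any sequence in $\partial\mathbb{D}$, where $\mathbb{D}$ is the unit disc, and put \[ F_n(z)=\frac{\lambda_n z+a_n}{1+\lambda_n a_n z},\qquad n\ge0 . \] Then, for all $z\in\mathbb{D}$, $F_n(z)\to1$ as $n\to\infty$. (ii) If, in addition, $\sum_{n\ge0}(1-F_n(0))=\sum_{n\ge0}(1-a_n)=\infty$, then there exists a sequence $(\lambda_n)$ in $\partial\mathbb{D}$ such that no point $\zeta\in\partial\mathbb{D}$ (even the point $1$) has an orbit $(F_n(\zeta))$ that converges to $1$; in other words, the Denjoy--Wolff set of $(F_n)$ is empty.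
   Context: The maps $F_n$ are Möbius maps and so are defined on $\overline{\mathbb{D}}$. For a sequence of holomorphic self-maps of $\mathbb{D}$ (here defined also on $\partial\mathbb{D}$) with $|F_n(z)|\to1$ as $n\to\infty$ for all $z\in\mathbb{D}$, the Denjoy--Wolff set of $(F_n)$ is the set of $\zeta\in\partial\mathbb{D}$ such that, for all $z\in\mathbb{D}$, $|F_n(\zeta)-F_n(z)|\to0$ as $n\to\infty$. *)

theory Defs
  imports "HOL-Analysis.Analysis"
begin

definition moebius_seq ::
    "(nat \<Rightarrow> real) \<Rightarrow> (nat \<Rightarrow> complex) \<Rightarrow> nat \<Rightarrow> complex \<Rightarrow> complex" where
  "moebius_seq a lam n z =
     (lam n * z + of_real (a n)) / (1 + lam n * of_real (a n) * z)"

lemma moebius_seq_0 [simp]: "moebius_seq a lam n 0 = of_real (a n)"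
  by (simp add: moebius_seq_def)

(* The notion is intended for sequences of holomorphic self-maps of the open unit
   disc, defined also on the unit circle, with cmod (F n z) tending to 1 for every
   z in the disc.  The definition does not enforce this. *)
definition denjoy_wolff_set :: "(nat \<Rightarrow> complex \<Rightarrow> complex) \<Rightarrow> complex set" where
  "denjoy_wolff_set F =
     {\<zeta> \<in> sphere 0 1. \<forall>z \<in> ball 0 1. (\<lambda>n. cmod (F n \<zeta> - F n z)) \<longlonglongrightarrow> 0}"

end

theory Submission
  imports Defs
begin

text \<open>With \<open>w = \<lambda>\<^sub>n z\<close> one has \<open>F\<^sub>n(z) - 1 = (1 - a\<^sub>n)(w - 1) / (1 + a\<^sub>n w)\<close>. For \<open>|z| < 1\<close> the
  denominator is bounded away from 0, which gives (i). For \<open>|z| = 1\<close> the quotient has modulus at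
  least 1/2 as soon as \<open>|w + 1| \<le> 1 - a\<^sub>n\<close>. Taking \<open>\<lambda>\<^sub>n = -exp(-i S\<^sub>n)\<close> with \<open>S\<^sub>n = \<Sum>k<n. 1 - a\<^sub>k\<close>, this
  condition holds whenever \<open>arg z\<close> lies, modulo \<open>2\<pi>\<close>, in \<open>[S\<^sub>n, S\<^sub>n\<^sub>+\<^sub>1)\<close>; as \<open>S\<^sub>n\<close> tends to infinity,
  these arcs sweep over every boundary point infinitely often.\<close>

text \<open>Isolates the factor \<open>1 - a n\<close>, so that only the remaining quotient has to
  be estimated. At a zero of the denominator the identity would fail, since division by 0 gives 0:
  the left side would be 1, the right side 0.\<close>

lemma cmod_moebius_seq_minus_1:
  assumes "a n \<le> 1" and nz: "1 + lam n * of_real (a n) * z \<noteq> 0"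
  shows "cmod (moebius_seq a lam n z - 1) =
           (1 - a n) * (cmod (lam n * z - 1) / cmod (1 + lam n * of_real (a n) * z))"
proof -
  have "moebius_seq a lam n z - 1 =
          of_real (1 - a n) * ((lam n * z - 1) / (1 + lam n * of_real (a n) * z))"
    using nz by (simp add: moebius_seq_def field_simps)
  then show ?thesis
    using assms(1) by (simp only: norm_mult norm_divide norm_of_real)
qed

text \<open>The quotient is at most \<open>2 / (1 - cmod z)\<close>, uniformly in \<open>n\<close>,
  so the factor \<open>1 - a n\<close> forces convergence.\<close>

lemma moebius_seq_tendsto_1:
  assumes a: "\<And>n. a n \<in> {0..<1}" "a \<longlonglongrightarrow> 1"
    and lam: "\<And>n. cmod (lam n) = 1" and z: "cmod z < 1"
  shows "(\<lambda>n. moebius_seq a lam n z) \<longlonglongrightarrow> 1"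
proof -
  have bound: "cmod (moebius_seq a lam n z - 1) \<le> (1 - a n) * (2 / (1 - cmod z))" for n
  proof -
    have "cmod (lam n * of_real (a n) * z) \<le> cmod z"
      using a(1)[of n] by (auto simp: norm_mult lam intro!: mult_left_le_one_le)
    moreover have "1 \<le> cmod (1 + lam n * of_real (a n) * z) + cmod (lam n * of_real (a n) * z)"
      using norm_triangle_ineq4[of "1 + lam n * of_real (a n) * z" "lam n * of_real (a n) * z"]
      by simp
    ultimately have den: "1 - cmod z \<le> cmod (1 + lam n * of_real (a n) * z)"
      by linarith
    have "cmod (lam n * z - 1) \<le> 2"
      using norm_triangle_ineq4[of "lam n * z" 1] z by (simp add: norm_mult lam)
    then have "cmod (lam n * z - 1) / cmod (1 + lam n * of_real (a n) * z) \<le> 2 / (1 - cmod z)"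
      using den z by (intro frac_le) auto
    moreover have "1 + lam n * of_real (a n) * z \<noteq> 0"
      using den z by auto
    moreover have "a n \<le> 1"
      using a(1)[of n] by simp
    ultimately show ?thesis
      by (subst cmod_moebius_seq_minus_1) (auto intro!: mult_left_mono simp del: times_divide_eq_right)
  qed
  have "(\<lambda>n. (1 - a n) * (2 / (1 - cmod z))) \<longlonglongrightarrow> (1 - 1) * (2 / (1 - cmod z))"
    by (intro tendsto_intros a(2))
  then have "(\<lambda>n. moebius_seq a lam n z - 1) \<longlonglongrightarrow> 0"
    by (intro Lim_null_comparison[OF always_eventually[OF allI[OF bound]]]) simp
  then show ?thesis
    using LIM_zero_iff by blast
qed

lemma moebius_seq_far_from_1:
  assumes a: "a n \<in> {0..<1}" and w: "cmod (lam n * z) = 1" "cmod (lam n * z + 1) \<le> 1 - a n"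
  shows "1 / 2 \<le> cmod (moebius_seq a lam n z - 1)"
proof -
  define d where "d = 1 + lam n * of_real (a n) * z"
  have "d \<noteq> 0"
  proof
    assume "d = 0"
    then have "lam n * z * of_real (a n) = -1"
      by (simp add: d_def algebra_simps add_eq_0_iff)
    then have "cmod (lam n * z) * \<bar>a n\<bar> = 1"
      by (metis norm_minus_cancel norm_mult norm_of_real norm_one)
    with a w(1) show False by simp
  qed
  \<comment> \<open>Expanding around \<open>lam n * z = -1\<close> splits \<open>d\<close> into two
    terms of modulus at most \<open>1 - a n\<close>, the same order as the factor in front of the
    quotient.\<close>
  have "d = of_real (1 - a n) + of_real (a n) * (lam n * z + 1)"
    by (simp add: d_def algebra_simps)
  then have "cmod d \<le> cmod (of_real (1 - a n)) + cmod (of_real (a n) * (lam n * z + 1))"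
    by (metis norm_triangle_ineq)
  also have "\<dots> = (1 - a n) + a n * cmod (lam n * z + 1)"
    using a unfolding norm_mult norm_of_real by auto
  also have "\<dots> \<le> (1 - a n) + 1 * (1 - a n)"
    using a w(2) by (intro add_left_mono mult_mono) auto
  finally have den: "cmod d \<le> 2 * (1 - a n)"
    by simp
  \<comment> \<open>The points 1 and -1 are at distance 2, and \<open>lam n * z\<close> lies within
    1 of -1.\<close>
  have "2 \<le> cmod (lam n * z - 1) + cmod (lam n * z + 1)"
    using norm_triangle_ineq4[of "lam n * z + 1" "lam n * z - 1"] by simp
  then have "1 \<le> cmod (lam n * z - 1)"
    using a w(2) by simp
  then have "(1 - a n) * 1 \<le> (1 - a n) * cmod (lam n * z - 1)"
    using a by (intro mult_left_mono) auto
  with den have "1 / 2 * cmod d \<le> (1 - a n) * cmod (lam n * z - 1)"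
    by linarith
  then have "1 / 2 \<le> (1 - a n) * cmod (lam n * z - 1) / cmod d"
    using \<open>d \<noteq> 0\<close> by (subst pos_le_divide_eq) auto
  also have "\<dots> = cmod (moebius_seq a lam n z - 1)"
    using cmod_moebius_seq_minus_1[of a n lam z] \<open>d \<noteq> 0\<close> a by (simp add: d_def)
  finally show ?thesis .
qed

text \<open>The index just before the first \<open>k \<ge> N\<close> with \<open>x < S k\<close>
  works: it is still at least \<open>N\<close>, because \<open>S N \<le> x\<close> excludes
  \<open>k = N\<close>.\<close>

lemma partial_sums_hit:
  fixes S :: "nat \<Rightarrow> real"
  assumes "filterlim S at_top sequentially" and "S N \<le> x"
  obtains n where "N \<le> n" "S n \<le> x" "x < S (Suc n)"
proof -
  obtain M where M: "\<And>n. n \<ge> M \<Longrightarrow> x < S n"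
    using assms(1) by (auto simp: filterlim_at_top_dense eventually_sequentially)
  define k where "k = (LEAST k. N \<le> k \<and> x < S k)"
  have k: "N \<le> k \<and> x < S k"
    unfolding k_def by (rule LeastI[of _ "max M N"]) (simp add: M)
  with assms(2) have "k \<noteq> N" by auto
  with k obtain n where n: "k = Suc n" "N \<le> n"
    by (cases k) auto
  then have "\<not> (N \<le> n \<and> x < S n)"
    unfolding k_def by (metis lessI not_less_Least)
  with n k that show ?thesis by auto
qed

text \<open>A chord is no longer than its arc: the left side is
  \<open>2 * \<bar>sin (t / 2)\<bar>\<close>.\<close>

lemma cmod_cis_minus_1_le: "cmod (cis t - 1) \<le> \<bar>t\<bar>"
  using abs_sin_x_le_abs_x[of "t / 2"] by (simp add: cis_conv_exp dist_exp_i_1)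

lemma sweeping_rotation:
  fixes d :: "nat \<Rightarrow> real"
  assumes "filterlim (\<lambda>N. \<Sum>n<N. d n) at_top sequentially" and z: "cmod z = 1"
  shows "\<exists>n\<ge>N. cmod (1 - cis (- (\<Sum>k<n. d k)) * z) \<le> d n"
proof -
  define S where "S n = (\<Sum>k<n. d k)" for n
  obtain t where t: "z = cis t"
    using z by (metis complex_norm_eq_1_exp cis_conv_exp)
  \<comment> \<open>Enough full turns are added to the argument of \<open>z\<close> to reach
    \<open>S N\<close>, which makes the index found below at least \<open>N\<close>.\<close>
  define m where "m = \<lceil>(S N - t) / (2 * pi)\<rceil>"
  define x where "x = t + 2 * pi * of_int m"
  have "(S N - t) / (2 * pi) \<le> of_int m"
    by (simp add: m_def)
  then have "S N \<le> x"
    by (simp add: x_def field_simps)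
  then obtain n where n: "N \<le> n" "S n \<le> x" "x < S (Suc n)"
    using partial_sums_hit[of S N x] assms(1) unfolding S_def by auto
  have "cis (- S n) * z = cis (x - S n)"
    using cis_mult[of "t - S n" "2 * pi * of_int m"]
    by (simp add: t x_def cis_mult add_diff_eq diff_add_eq)
  then have "cmod (1 - cis (- S n) * z) \<le> \<bar>x - S n\<bar>"
    using cmod_cis_minus_1_le[of "x - S n"] by (simp add: norm_minus_commute)
  also have "\<dots> \<le> d n"
    using n by (simp add: S_def)
  finally show ?thesis
    using n(1) unfolding S_def by blast
qed

theorem theoremD:
  fixes a :: "nat \<Rightarrow> real"
  assumes "incseq a"
    and "\<And>n. a n \<in> {0..<1}"
    and "a 0 = 0"
    and "a \<longlonglongrightarrow> 1"
  shows "(\<forall>lam :: nat \<Rightarrow> complex. (\<forall>n. lam n \<in> sphere 0 1) \<longrightarrow>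
            (\<forall>z \<in> ball 0 1. (\<lambda>n. moebius_seq a lam n z) \<longlonglongrightarrow> 1)) \<and>
         (filterlim (\<lambda>N. \<Sum>n<N. 1 - a n) at_top sequentially \<longrightarrow>
            (\<exists>lam :: nat \<Rightarrow> complex. (\<forall>n. lam n \<in> sphere 0 1) \<and>
               (\<forall>\<zeta> \<in> sphere 0 1. \<not> (\<lambda>n. moebius_seq a lam n \<zeta>) \<longlonglongrightarrow> 1) \<and>
               denjoy_wolff_set (moebius_seq a lam) = {}))"
proof (intro conjI impI allI ballI)
  fix lam :: "nat \<Rightarrow> complex" and z :: complex
  assume "\<forall>n. lam n \<in> sphere 0 1" "z \<in> ball 0 1"
  then show "(\<lambda>n. moebius_seq a lam n z) \<longlonglongrightarrow> 1"
    using assms by (intro moebius_seq_tendsto_1) auto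
next
  assume div: "filterlim (\<lambda>N. \<Sum>n<N. 1 - a n) at_top sequentially"
  \<comment> \<open>The minus sign moves the target of the sweep from 1 to -1, near the pole of the
    map in the variable \<open>lam n * z\<close>.\<close>
  define lam where "lam n = - cis (- (\<Sum>k<n. 1 - a k))" for n
  have lam: "cmod (lam n) = 1" for n
    by (simp add: lam_def)
  have no_conv: "\<not> (\<lambda>n. moebius_seq a lam n \<zeta>) \<longlonglongrightarrow> 1" if "\<zeta> \<in> sphere 0 1" for \<zeta>
  proof
    assume "(\<lambda>n. moebius_seq a lam n \<zeta>) \<longlonglongrightarrow> 1"
    then obtain N where N: "\<And>n. n \<ge> N \<Longrightarrow> cmod (moebius_seq a lam n \<zeta> - 1) < 1 / 2"
      by (metis LIMSEQ_D half_gt_zero_iff zero_less_one)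
    have "cmod \<zeta> = 1" using that by simp
    then obtain n where n: "n \<ge> N" "cmod (1 - cis (- (\<Sum>k<n. 1 - a k)) * \<zeta>) \<le> 1 - a n"
      using sweeping_rotation[OF div] by blast
    have "1 / 2 \<le> cmod (moebius_seq a lam n \<zeta> - 1)"
    proof (rule moebius_seq_far_from_1)
      show "cmod (lam n * \<zeta> + 1) \<le> 1 - a n"
        using n(2) by (simp add: lam_def)
    qed (use assms(2) \<open>cmod \<zeta> = 1\<close> in \<open>simp_all only: norm_mult lam mult_1_left\<close>)
    with N[OF n(1)] show False by simp
  qed
  have "denjoy_wolff_set (moebius_seq a lam) = {}"
  proof (rule ccontr)
    assume "denjoy_wolff_set (moebius_seq a lam) \<noteq> {}"
    then obtain \<zeta> where \<zeta>: "\<zeta> \<in> sphere 0 1"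
      and DW: "\<forall>z \<in> ball 0 1.
        (\<lambda>n. cmod (moebius_seq a lam n \<zeta> - moebius_seq a lam n z)) \<longlonglongrightarrow> 0"
      unfolding denjoy_wolff_set_def by blast
    \<comment> \<open>The orbit of 0 is \<open>a n\<close>, which tends to 1, so a Denjoy-Wolff
      point would have an orbit converging to 1.\<close>
    from DW[rule_format, of 0] have "(\<lambda>n. moebius_seq a lam n \<zeta> - of_real (a n)) \<longlonglongrightarrow> 0"
      by (simp add: tendsto_norm_zero_iff)
    from tendsto_add[OF this tendsto_of_real[OF assms(4)]]
    have "(\<lambda>n. moebius_seq a lam n \<zeta>) \<longlonglongrightarrow> 1" by simp
    with no_conv \<zeta> show False by blast
  qed
  with no_conv lam
  show "\<exists>lam. (\<forall>n. lam n \<in> sphere 0 1) \<and>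
          (\<forall>\<zeta> \<in> sphere 0 1. \<not> (\<lambda>n. moebius_seq a lam n \<zeta>) \<longlonglongrightarrow> 1) \<and>
          denjoy_wolff_set (moebius_seq a lam) = {}"
    by (intro exI[of _ lam]) auto
qed

end
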